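(* Let $X$ be a real Banach space, let $k\in\mathbb{N}$, and let $(V_j)_{j\in\mathbb{N}}\subset\mathcal{G}^k(X)$ be a sequence of closed subspaces of codimension $k$. Assume that there exists a well-separating common complement of $(V_j)_{j\in\mathbb{N}}$. Then the set of all $(x_1,\dots,x_k)\in X^k$ such that $\mathrm{span}(x_1,\dots,x_k)$ is a well-separating common complement of $(V_j)_{j\in\mathbb{N}}$ is a prevalent subset of $X^k$.
   Context: All vector spaces are real and $\mathbb{N}=\{1,2,\dots\}$. For a Banach space $X$, $\mathcal{G}_k(X)$ is the set of $k$-dimensional subspaces of $X$ and $\mathcal{G}^k(X)$ is the set of closed subspaces of $X$ of codimension $k$. For $x\in X$ and $V\subset X$, $\mathrm{d}(x,V)=\inf_{v\in V}\|x-v\|$. Let $(V_j)_{j\in\mathbb{N}}\subset\mathcal{G}^k(X)$. A common complement of $(V_j)_{j\in\mathbb{N}}$ is a subspace $C\in\mathcal{G}_k(X)$ with $X=C\oplus V_j$ for all $j$. Given $\delta=(\delta_j)_{j\in\mathbb{N}}\subset\mathbb{R}_{>0}$, a common complement $C$ is called $\delta$-separating if $\inf_{x\in C,\ \|x\|=1}\mathrm{d}(x,V_j)\ge\delta_j$ for all $j\in\mathbb{N}$. It is called well-separating if it is $\delta$-separating for some $\delta=(\delta_j)_{j\in\mathbb{N}}\subset\mathbb{R}_{>0}$ with $\lim_{j\to\infty}\frac1j\log\delta_j=0$. The product $X^k$ is a Banach space with norm $\|(x_1,\dots,x_k)\|_{X^k}=\|x_1\|+\dots+\|x_k\|$. Prevalence: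 A Borel subset $E$ of a Banach space $Y$ is called prevalent if there exists a Borel measure $\mu$ on $Y$ such that (1) $0<\mu(K)<\infty$ for some compact set $K\subset Y$, and (2) for all $y\in Y$ the translate $E+y$ has full $\mu$-measure (i.e. $\mu(Y\setminus(E+y))=0$). A general subset $F\subset Y$ is called prevalent if it contains a prevalent Borel set. *)

theory Defs
  imports "HOL-Analysis.Analysis"
begin

definition subspaces_of_dim :: "nat \<Rightarrow> 'a::real_vector set set" where
  "subspaces_of_dim k = {C. subspace C \<and> (\<exists>B. finite B \<and> span B = C) \<and> dim C = k}"

(* The residue classes of the elements of B form a basis of the quotient X / V,
   written out with representatives. *)
definition basis_modulo :: "'a::real_vector set \<Rightarrow> 'a set \<Rightarrow> bool" where
  "basis_modulo V B \<longleftrightarrow> finite B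
     \<and> (\<forall>u. (\<Sum>b\<in>B. u b *\<^sub>R b) \<in> V \<longrightarrow> (\<forall>b\<in>B. u b = 0))
     \<and> (\<forall>x. \<exists>u. x - (\<Sum>b\<in>B. u b *\<^sub>R b) \<in> V)"

definition has_codim :: "'a::real_vector set \<Rightarrow> nat \<Rightarrow> bool" where
  "has_codim V k \<longleftrightarrow> (\<exists>B. basis_modulo V B \<and> card B = k)"

definition closed_subspaces_of_codim :: "nat \<Rightarrow> 'a::real_normed_vector set set" where
  "closed_subspaces_of_codim k = {V. subspace V \<and> closed V \<and> has_codim V k}"

definition direct_sum_decomp :: "'a::real_vector set \<Rightarrow> 'a set \<Rightarrow> bool" where
  "direct_sum_decomp C V \<longleftrightarrow> {c + v |c v. c \<in> C \<and> v \<in> V} = UNIV \<and> C \<inter> V = {0}"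

(* Sequences are indexed by {1,2,...}; their value at index 0 is irrelevant. *)
definition common_complement ::
    "nat \<Rightarrow> (nat \<Rightarrow> 'a::real_normed_vector set) \<Rightarrow> 'a set \<Rightarrow> bool" where
  "common_complement k V C \<longleftrightarrow>
     C \<in> subspaces_of_dim k \<and> (\<forall>j\<ge>1. direct_sum_decomp C (V j))"

(* Intended for k > 0 only, so that the unit sphere of C is nonempty
   and the real-valued infimum is the usual one. *)
definition delta_separating ::
    "nat \<Rightarrow> (nat \<Rightarrow> 'a::real_normed_vector set) \<Rightarrow> (nat \<Rightarrow> real) \<Rightarrow> 'a set \<Rightarrow> bool" where
  "delta_separating k V \<delta> C \<longleftrightarrow> common_complement k V C
     \<and> (\<forall>j\<ge>1. (INF x\<in>{x \<in> C. norm x = 1}. infdist x (V j)) \<ge> \<delta> j)"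

definition well_separating ::
    "nat \<Rightarrow> (nat \<Rightarrow> 'a::real_normed_vector set) \<Rightarrow> 'a set \<Rightarrow> bool" where
  "well_separating k V C \<longleftrightarrow>
     (\<exists>\<delta>. (\<forall>j\<ge>1. \<delta> j > 0) \<and> delta_separating k V \<delta> C
        \<and> (\<lambda>j. (1 / real j) * ln (\<delta> j)) \<longlonglongrightarrow> 0)"

definition prevalent_borel :: "'b::banach set \<Rightarrow> bool" where
  "prevalent_borel E \<longleftrightarrow> E \<in> sets borel
     \<and> (\<exists>\<mu> :: 'b measure. sets \<mu> = sets borel
          \<and> (\<exists>K. compact K \<and> 0 < emeasure \<mu> K \<and> emeasure \<mu> K < \<infinity>)
          \<and> (\<forall>y. emeasure \<mu> (UNIV - (\<lambda>x. x + y) ` E) = 0))"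

definition prevalent :: "'b::banach set \<Rightarrow> bool" where
  "prevalent F \<longleftrightarrow> (\<exists>E. E \<subseteq> F \<and> prevalent_borel E)"

(* The product X^k is modelled by 'a ^ 'n with CARD('n) = k. The library norm on this type
   is the Euclidean combination of the component norms. It is equivalent to the sum norm
   and so induces the same open, Borel and compact sets, hence the same prevalent sets. *)
lemma norm_vec_le_sum_norm: "norm x \<le> (\<Sum>i\<in>UNIV. norm (x $ i))"
  for x :: "'a::real_normed_vector ^ 'n"
  by (simp add: norm_vec_def L2_set_le_sum)

lemma sum_norm_le_norm_vec: "(\<Sum>i\<in>UNIV. norm (x $ i)) \<le> real CARD('n) * norm x"
  for x :: "'a::real_normed_vector ^ 'n"
  by (rule sum_bounded_above) (rule Finite_Cartesian_Product.norm_nth_le)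

lemma open_vec_iff_sum_norm:
  fixes S :: "('a::real_normed_vector ^ 'n) set"
  shows "open S \<longleftrightarrow>
    (\<forall>x\<in>S. \<exists>e>0. \<forall>y. (\<Sum>i\<in>UNIV. norm ((y - x) $ i)) < e \<longrightarrow> y \<in> S)"
proof
  assume S: "open S"
  show "\<forall>x\<in>S. \<exists>e>0. \<forall>y. (\<Sum>i\<in>UNIV. norm ((y - x) $ i)) < e \<longrightarrow> y \<in> S"
  proof
    fix x assume "x \<in> S"
    with S obtain e where "e > 0" and e: "\<And>y. dist y x < e \<Longrightarrow> y \<in> S"
      unfolding open_dist by blast
    have "y \<in> S" if "(\<Sum>i\<in>UNIV. norm ((y - x) $ i)) < e" for y
      using e[of y] norm_vec_le_sum_norm[of "y - x"] that unfolding dist_norm by linarith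
    with \<open>e > 0\<close> show "\<exists>e>0. \<forall>y. (\<Sum>i\<in>UNIV. norm ((y - x) $ i)) < e \<longrightarrow> y \<in> S"
      by blast
  qed
next
  assume R: "\<forall>x\<in>S. \<exists>e>0. \<forall>y. (\<Sum>i\<in>UNIV. norm ((y - x) $ i)) < e \<longrightarrow> y \<in> S"
  show "open S"
    unfolding open_dist
  proof
    fix x assume "x \<in> S"
    with R obtain e where "e > 0"
      and e: "\<And>y. (\<Sum>i\<in>UNIV. norm ((y - x) $ i)) < e \<Longrightarrow> y \<in> S" by blast
    have "y \<in> S" if "dist y x < e / real CARD('n)" for y
    proof (rule e)
      have "real CARD('n) * norm (y - x) < e"
        using that by (simp add: dist_norm pos_less_divide_eq mult.commute)
      with sum_norm_le_norm_vec[of "y - x"]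
      show "(\<Sum>i\<in>UNIV. norm ((y - x) $ i)) < e" by linarith
    qed
    moreover have "e / real CARD('n) > 0" using \<open>e > 0\<close> by simp
    ultimately show "\<exists>e>0. \<forall>y. dist y x < e \<longrightarrow> y \<in> S" by blast
  qed
qed

end

theory Submission
  imports Defs "HOL-Computational_Algebra.Fundamental_Theorem_Algebra"
begin

text \<open>
  Write \<open>k\<close> for the common codimension and let \<open>c = (c\<^sub>1, \<dots>, c\<^sub>k)\<close> be a basis of a well-separating
  common complement. The probe measure on \<open>X\<^sup>k\<close> is Lebesgue measure on the single line
  \<open>t \<mapsto> t c\<close>. Hence it must be shown that, for every \<open>y \<in> X\<^sup>k\<close>, the tuple \<open>t c + y\<close> spans a
  well-separating common complement for almost every real \<open>t\<close>.

  Modulo \<open>V\<^sub>j\<close>, each \<open>y\<^sub>i\<close> is a linear combination of the basis \<open>c\<close>. Let \<open>Z\<^sub>j\<close> be the matrix of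
  coefficients; then \<open>\<Sum>\<^sub>i s\<^sub>i (t c\<^sub>i + y\<^sub>i)\<close> is congruent modulo \<open>V\<^sub>j\<close> to the combination of \<open>c\<close> with
  coefficient vector \<open>(t I + Z\<^sub>j) s\<close>. So the separation of \<open>t c + y\<close> from \<open>V\<^sub>j\<close> is governed by a lower
  bound for \<open>t I + Z\<^sub>j\<close>. Cramer's rule gives one in terms of \<open>det (t I + Z\<^sub>j)\<close>, losing powers of the
  entries of \<open>Z\<^sub>j\<close>, and these entries are at most \<open>\<parallel>y\<parallel>\<close> over the separation \<open>\<eta>\<^sub>j\<close> of \<open>c\<close> from \<open>V\<^sub>j\<close>.
  As \<open>\<eta>\<^sub>j\<close> is subexponential in \<open>j\<close>, this loss is harmless
  (\<open>det_mult_norm_le\<close>, \<open>separates_shift_along\<close>).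

  The determinant is a monic polynomial of degree \<open>k\<close> in \<open>t\<close>, and whatever its coefficients are,
  it is smaller than \<open>\<epsilon>\<^sup>k\<close> in absolute value only on a set of measure at most \<open>2 k \<epsilon>\<close>
  (\<open>emeasure_small_values_monic_poly\<close>). The choice \<open>\<epsilon> = 1 / (m j\<^sup>2)\<close> makes these measures summable over
  \<open>j\<close>, with a total of order \<open>1 / m\<close>. Letting \<open>m\<close> grow, almost every \<open>t\<close> admits an \<open>m\<close> such that
  \<open>t c + y\<close> is separated from every \<open>V\<^sub>j\<close> with constant \<open>(\<eta>\<^sub>j / j\<^sup>2)\<^sup>k / m\<close>, which is subexponential
  (\<open>separates_along_line_ae\<close>). The set of tuples with this last property, for some \<open>m\<close>, is a
  countable union of closed sets and supplies the Borel set that prevalence asks for.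
\<close>

section \<open>Characteristic polynomials and small determinants\<close>

text \<open>The determinant is expanded over the ring of polynomials. Only the identity permutation
  meets all \<open>n\<close> diagonal entries, which are the ones of degree one, so it alone contributes to the
  leading term.\<close>
lemma det_shift_monic_poly:
  fixes Z :: "'b::idom ^ 'n ^ 'n"
  obtains p where "degree p = CARD('n)" "lead_coeff p = 1" "\<And>t. poly p t = det (mat t + Z)"
proof -
  define D :: "'b poly ^ 'n ^ 'n" where "D = (\<chi> i j. if i = j then [:Z$i$j, 1:] else [:Z$i$j:])"
  define P where "P = {\<sigma>. \<sigma> permutes (UNIV :: 'n set)}"
  define T where "T = (\<lambda>\<sigma>. of_int (sign \<sigma>) * (\<Prod>i\<in>UNIV. D $ i $ \<sigma> i))"
  have "finite P" by (simp add: P_def)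
  have idP: "id \<in> P" by (simp add: P_def permutes_id)
  have detD: "det D = T id + sum T (P - {id})"
    unfolding det_def T_def P_def[symmetric]
    by (rule sum.remove[OF \<open>finite P\<close> idP])
  have Tid: "T id = (\<Prod>i\<in>UNIV. [:Z$i$i, 1:])"
    by (simp add: T_def D_def sign_id)
  have deg_id: "degree (T id) = CARD('n)"
    unfolding Tid by (subst degree_prod_eq_sum_degree) auto
  have lead_id: "lead_coeff (T id) = 1"
    unfolding Tid lead_coeff_prod by simp
  have deg_T: "degree (T \<sigma>) < CARD('n)" if "\<sigma> \<in> P - {id}" for \<sigma>
  proof -
    from that obtain a where a: "\<sigma> a \<noteq> a" by (auto simp: fun_eq_iff)
    have "degree (T \<sigma>) \<le> degree (\<Prod>i\<in>UNIV. D $ i $ \<sigma> i)"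
      unfolding T_def by (cases "sign \<sigma> = 1") (auto simp: sign_def)
    also have "\<dots> \<le> (\<Sum>i\<in>UNIV. degree (D $ i $ \<sigma> i))"
      using degree_prod_sum_le[of UNIV "\<lambda>i. D $ i $ \<sigma> i"] by (simp add: o_def)
    also have "\<dots> < (\<Sum>i\<in>(UNIV :: 'n set). 1)"
      by (rule sum_strict_mono_ex1) (use a in \<open>auto simp: D_def intro!: exI[of _ a]\<close>)
    finally show ?thesis by simp
  qed
  have deg_rest: "degree (sum T (P - {id})) < degree (T id)"
    unfolding deg_id
    by (rule degree_sum_less) (use deg_T in auto)
  have ev: "poly (det D) t = det (mat t + Z)" for t
  proof -
    have "poly (D $ i $ j) t = (mat t + Z) $ i $ j" for i j
      by (simp add: D_def mat_def)
    moreover have "poly (of_int (sign \<sigma>)) t = of_int (sign \<sigma>)" for \<sigma> :: "'n \<Rightarrow> 'n"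
      by (simp add: sign_def)
    ultimately show ?thesis
      by (simp add: det_def poly_sum poly_prod)
  qed
  show thesis
  proof (rule that[OF _ _ ev])
    show "degree (det D) = CARD('n)"
      using deg_rest by (simp add: detD degree_add_eq_left deg_id)
    then show "lead_coeff (det D) = 1"
      using deg_rest lead_id deg_id by (simp add: detD coeff_eq_0)
  qed
qed

text \<open>Over the complex numbers a monic polynomial is the product of the \<open>t - x\<close>, \<open>x\<close> running through
  its roots. If it is smaller than \<open>\<epsilon>\<close> to the power of its degree, some factor is smaller than \<open>\<epsilon>\<close>,
  so the real number \<open>t\<close> lies within \<open>\<epsilon>\<close> of the real part of a root. The bound does not depend on the
  coefficients; this uniformity is what allows summation over all subspaces of the sequence.\<close>
lemma emeasure_small_values_monic_poly:
  fixes p :: "real poly"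
    and \<epsilon> :: real
  assumes "lead_coeff p = 1" and "\<epsilon> \<ge> 0"
  shows "emeasure lborel {t. \<bar>poly p t\<bar> < \<epsilon> ^ degree p} \<le> ennreal (2 * degree p * \<epsilon>)"
proof -
  define q where "q = map_poly complex_of_real p"
  have dq: "degree q = degree p"
    unfolding q_def by (rule degree_map_poly) auto
  have lq: "lead_coeff q = 1"
    using assms by (simp add: q_def coeff_map_poly degree_map_poly)
  then have "q \<noteq> 0" by auto
  then obtain A where A: "size A = degree q" "q = (\<Prod>x\<in>#A. [:-x, 1:])"
    using alg_closed_imp_factorization[of q] lq by auto
  have pq: "complex_of_real (poly p t) = poly q (of_real t)" for t
    unfolding q_def poly_altdef by (simp add: degree_map_poly coeff_map_poly)
  have norm_ge: "\<epsilon> ^ size B \<le> norm (poly (\<Prod>x\<in>#B. [:-x, 1:]) w)"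
    if "\<And>x. x \<in># B \<Longrightarrow> \<epsilon> \<le> norm (w - x)" for B and w :: complex
    using that
  proof (induction B)
    case (add x B)
    have "\<epsilon> * \<epsilon> ^ size B \<le> norm (w - x) * norm (poly (\<Prod>x\<in>#B. [:-x, 1:]) w)"
      using add assms(2) by (intro mult_mono) auto
    also have "\<dots> = norm (poly (\<Prod>x\<in>#add_mset x B. [:-x, 1:]) w)"
      by (simp add: norm_mult[symmetric] algebra_simps)
    finally show ?case by simp
  qed simp
  have sub: "{t. \<bar>poly p t\<bar> < \<epsilon> ^ degree p} \<subseteq> (\<Union>x\<in>set_mset A. {Re x - \<epsilon> .. Re x + \<epsilon>})"
  proof clarify
    fix t assume t: "\<bar>poly p t\<bar> < \<epsilon> ^ degree p"
    then have "norm (poly q (of_real t)) < \<epsilon> ^ size A"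
      by (simp add: A(1) dq flip: pq)
    with norm_ge[of A "of_real t"] obtain x where x: "x \<in># A" "norm (of_real t - x) < \<epsilon>"
      unfolding A(2) by force
    have "\<bar>t - Re x\<bar> < \<epsilon>"
      using abs_Re_le_cmod[of "of_real t - x"] x(2) by simp
    with x(1) show "t \<in> (\<Union>x\<in>set_mset A. {Re x - \<epsilon> .. Re x + \<epsilon>})"
      by (intro UN_I[of x]) auto
  qed
  have "emeasure lborel {t. \<bar>poly p t\<bar> < \<epsilon> ^ degree p}
      \<le> emeasure lborel (\<Union>x\<in>set_mset A. {Re x - \<epsilon> .. Re x + \<epsilon>})"
    by (rule emeasure_mono[OF sub]) auto
  also have "\<dots> \<le> (\<Sum>x\<in>set_mset A. emeasure lborel {Re x - \<epsilon> .. Re x + \<epsilon>})"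
    by (rule emeasure_subadditive_finite) auto
  also have "\<dots> = (\<Sum>x\<in>set_mset A. ennreal (2 * \<epsilon>))"
    using assms(2) by (intro sum.cong) auto
  also have "\<dots> = ennreal (card (set_mset A) * (2 * \<epsilon>))"
    using assms(2) by (simp add: ennreal_mult ennreal_of_nat_eq_real_of_nat)
  also have "\<dots> \<le> ennreal (2 * degree p * \<epsilon>)"
  proof (rule ennreal_leI)
    have "(\<Sum>x\<in>set_mset A. 1) \<le> (\<Sum>x\<in>set_mset A. count A x)"
      by (rule sum_mono) simp
    then have "card (set_mset A) \<le> degree p"
      using A(1) dq by (simp add: size_multiset_overloaded_eq)
    then show "card (set_mset A) * (2 * \<epsilon>) \<le> 2 * degree p * \<epsilon>"
      using assms(2) by (simp add: mult_right_mono)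
  qed
  finally show ?thesis .
qed

lemma det_replace_column_le:
  fixes B :: "real ^ 'n ^ 'n" and b :: real
  assumes B: "\<And>i j. \<bar>B$i$j\<bar> \<le> b" and w: "\<And>i. \<bar>w$i\<bar> \<le> c"
  shows "\<bar>det (\<chi> i j. if j = k then w$i else B$i$j)\<bar> \<le> fact CARD('n) * (c * b ^ (CARD('n) - 1))"
proof -
  define P where "P = {\<sigma>. \<sigma> permutes (UNIV :: 'n set)}"
  define D where "D = (\<chi> i j. if j = k then w$i else B$i$j)"
  have summand: "\<bar>of_int (sign \<sigma>) * (\<Prod>i\<in>UNIV. D$i$\<sigma> i)\<bar> \<le> c * b ^ (CARD('n) - 1)"
    if "\<sigma> \<in> P" for \<sigma>
  proof -
    have "\<bar>of_int (sign \<sigma>) * (\<Prod>i\<in>UNIV. D$i$\<sigma> i)\<bar> = (\<Prod>i\<in>UNIV. \<bar>D$i$\<sigma> i\<bar>)"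
      by (simp add: abs_mult abs_prod sign_def)
    also have "\<dots> \<le> (\<Prod>i\<in>UNIV. (if \<sigma> i = k then c else b))"
      by (rule prod_mono) (use B w in \<open>auto simp: D_def\<close>)
    \<comment> \<open>A permutation picks exactly one entry from the replaced column.\<close>
    also have "\<dots> = (\<Prod>j\<in>UNIV. (if j = k then c else b))"
      using prod.permute[of \<sigma> UNIV "\<lambda>j. if j = k then c else b"] that
      by (simp add: P_def o_def)
    also have "\<dots> = c * (\<Prod>j\<in>UNIV - {k}. (if j = k then c else b))"
      by (subst prod.remove[of _ k]) auto
    also have "(\<Prod>j\<in>UNIV - {k}. (if j = k then c else b)) = b ^ (CARD('n) - 1)"
      by (subst prod.cong[of _ "UNIV - {k}" _ "\<lambda>_. b"]) (auto simp: card_Diff_singleton)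
    finally show ?thesis .
  qed
  have "\<bar>det D\<bar> \<le> (\<Sum>\<sigma>\<in>P. \<bar>of_int (sign \<sigma>) * (\<Prod>i\<in>UNIV. D$i$\<sigma> i)\<bar>)"
    unfolding det_def P_def by (rule sum_abs)
  also have "\<dots> \<le> (\<Sum>\<sigma>\<in>P. c * b ^ (CARD('n) - 1))"
    by (rule sum_mono) (rule summand)
  also have "\<dots> = fact CARD('n) * (c * b ^ (CARD('n) - 1))"
    by (simp add: P_def card_permutations)
  finally show ?thesis by (simp add: D_def)
qed

text \<open>A quantitative form of invertibility: by Cramer's rule, \<open>s\<^sub>k det B\<close> is the determinant of \<open>B\<close>
  with column \<open>k\<close> replaced by \<open>B s\<close>.\<close>
lemma det_mult_norm_le:
  fixes B :: "real ^ 'n ^ 'n" and b :: real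
  assumes B: "\<And>i j. \<bar>B$i$j\<bar> \<le> b"
  shows "\<bar>det B\<bar> * norm s \<le> CARD('n) * fact CARD('n) * b ^ (CARD('n) - 1) * norm (B *v s)"
proof -
  have "\<bar>det B\<bar> * norm s \<le> \<bar>det B\<bar> * (\<Sum>k\<in>UNIV. \<bar>s$k\<bar>)"
    by (intro mult_left_mono norm_le_l1_cart) simp
  also have "\<dots> = (\<Sum>k\<in>UNIV. \<bar>s$k * det B\<bar>)"
    by (simp add: sum_distrib_left abs_mult mult.commute)
  also have "\<dots> \<le> (\<Sum>k\<in>(UNIV :: 'n set). fact CARD('n) * (norm (B *v s) * b ^ (CARD('n) - 1)))"
    unfolding cramer_lemma[symmetric]
    by (intro sum_mono det_replace_column_le B component_le_norm_cart)
  also have "\<dots> = CARD('n) * fact CARD('n) * b ^ (CARD('n) - 1) * norm (B *v s)"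
    by simp
  finally show ?thesis .
qed

section \<open>Tuples of vectors and complements\<close>

definition lincomb :: "'a::real_vector ^ 'n \<Rightarrow> real ^ 'n \<Rightarrow> 'a" where
  "lincomb x s = (\<Sum>i\<in>UNIV. s $ i *\<^sub>R x $ i)"

lemma linear_lincomb: "linear (lincomb x)"
  by (rule linearI) (simp_all add: lincomb_def scaleR_left_distrib sum.distrib scaleR_sum_right)

lemma lincomb_add_left: "lincomb (x + y) s = lincomb x s + lincomb y s"
  by (simp add: lincomb_def scaleR_right_distrib sum.distrib)

lemma lincomb_scaleR_left: "lincomb (t *\<^sub>R x) s = lincomb x (t *\<^sub>R s)"
  by (simp add: lincomb_def mult.commute)

lemma range_nth_eq_lincomb_image_Basis:
  fixes x :: "'a::real_vector ^ 'n"
  shows "range (\<lambda>i. x $ i) = lincomb x ` Basis"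
proof -
  have "lincomb x (axis i 1) = x $ i" for i
  proof -
    have "lincomb x (axis i 1) = (\<Sum>k\<in>UNIV. if k = i then x $ k else 0)"
      unfolding lincomb_def by (rule sum.cong) (auto simp: axis_def)
    then show ?thesis by simp
  qed
  moreover have B: "(Basis :: (real ^ 'n) set) = range (\<lambda>i. axis i (1 :: real))"
    by (auto simp: Basis_vec_def)
  ultimately show ?thesis unfolding B image_image by simp
qed

lemma span_range_nth: "span (range (\<lambda>i. x $ i)) = range (lincomb x)"
  unfolding range_nth_eq_lincomb_image_Basis
  by (simp add: linear_span_image[OF linear_lincomb])

lemma norm_lincomb_le:
  fixes x :: "'a::real_normed_vector ^ 'n"
  shows "norm (lincomb x s) \<le> (CARD('n) * norm x) * norm s"
proof -
  have "norm (lincomb x s) \<le> (\<Sum>i\<in>UNIV. norm (s $ i *\<^sub>R x $ i))"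
    unfolding lincomb_def by (rule norm_sum)
  also have "\<dots> \<le> (\<Sum>i\<in>(UNIV :: 'n set). norm s * norm x)"
  proof (rule sum_mono)
    fix i
    have "norm (s $ i *\<^sub>R x $ i) = norm (s $ i) * norm (x $ i)" by simp
    also have "\<dots> \<le> norm s * norm x"
      by (intro mult_mono Finite_Cartesian_Product.norm_nth_le) auto
    finally show "norm (s $ i *\<^sub>R x $ i) \<le> norm s * norm x" .
  qed
  finally show ?thesis by (simp add: mult_ac)
qed

lemma subspaces_of_dim_span_range_nth:
  fixes x :: "'a::real_vector ^ 'n"
  assumes "inj (lincomb x)"
  shows "span (range (\<lambda>i. x $ i)) \<in> subspaces_of_dim CARD('n)"
proof -
  have "independent (lincomb x ` Basis)"
    using assms by (intro linear_independent_injective_image[OF linear_lincomb] independent_Basis)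
      (rule inj_on_subset[OF _ subset_UNIV])
  then have "dim (range (\<lambda>i. x $ i)) = card (lincomb x ` (Basis :: (real ^ 'n) set))"
    unfolding range_nth_eq_lincomb_image_Basis by (rule dim_eq_card_independent)
  also have "\<dots> = CARD('n)"
    using card_image[OF inj_on_subset[OF assms subset_UNIV], of Basis] by simp
  finally show ?thesis
    by (auto simp: subspaces_of_dim_def intro!: exI[of _ "range (\<lambda>i. x $ i)"])
qed

lemma subspaces_of_dim_imp_lincomb:
  fixes C :: "'a::real_vector set"
  assumes "C \<in> subspaces_of_dim CARD('n)"
  obtains c :: "'a ^ 'n" where "C = range (lincomb c)" "inj (lincomb c)"
proof -
  have C: "subspace C" "dim C = CARD('n)"
    using assms by (auto simp: subspaces_of_dim_def)
  obtain B where B: "B \<subseteq> C" "independent B" "C \<subseteq> span B" "card B = CARD('n)"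
    using basis_exists[of C] unfolding C(2) by blast
  have "finite B" using B(4) by (intro card_ge_0_finite) simp
  then obtain h :: "'n \<Rightarrow> 'a" where h: "bij_betw h UNIV B"
    using finite_same_card_bij[of "UNIV :: 'n set" B] B(4) by auto
  define c where "c = (\<chi> i. h i)"
  have "range (lincomb c) = span (range (\<lambda>i. c $ i))"
    by (rule span_range_nth[symmetric])
  also have "range (\<lambda>i. c $ i) = B"
    using h by (auto simp: c_def bij_betw_def)
  also have "span B = C"
    by (intro subset_antisym span_minimal B C)
  finally have 1: "C = range (lincomb c)" ..
  have "s = 0" if "lincomb c s = 0" for s
  proof -
    have "(\<Sum>v\<in>B. s $ inv_into UNIV h v *\<^sub>R v) = lincomb c s"
      using sum.reindex_bij_betw[OF h, of "\<lambda>v. s $ inv_into UNIV h v *\<^sub>R v"] h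
      by (simp add: lincomb_def c_def bij_betw_def)
    then have "s $ inv_into UNIV h v = 0" if "v \<in> B" for v
      using independentD[OF B(2) \<open>finite B\<close>, of "\<lambda>v. s $ inv_into UNIV h v" v]
      that \<open>lincomb c s = 0\<close> by simp
    then have "s $ i = 0" for i
      using inv_into_f_f[of h UNIV i] bij_betwE[OF h] bij_betw_imp_inj_on[OF h] by fastforce
    then show "s = 0" by (simp add: vec_eq_iff)
  qed
  then have "inj (lincomb c)"
    by (simp add: linear_injective_0[OF linear_lincomb])
  with 1 show thesis by (rule that)
qed

text \<open>The unit sphere of coefficient vectors is compact, so the norm attains a positive minimum on its
  image. The normalisation \<open>\<kappa> \<le> 1\<close> keeps later separation constants below one.\<close>
lemma lincomb_bounded_below:
  fixes c :: "'a::real_normed_vector ^ 'n"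
  assumes "inj (lincomb c)"
  obtains \<kappa> where "\<kappa> > 0" "\<kappa> \<le> 1" "\<And>s. \<kappa> * norm s \<le> norm (lincomb c s)"
proof -
  have "continuous_on (sphere 0 1) (\<lambda>s. norm (lincomb c s))"
    unfolding lincomb_def by (intro continuous_intros)
  moreover have "sphere (0 :: real ^ 'n) 1 \<noteq> {}"
    by simp
  ultimately obtain u where u: "u \<in> sphere 0 1"
    and min: "\<And>s. s \<in> sphere 0 1 \<Longrightarrow> norm (lincomb c u) \<le> norm (lincomb c s)"
    using continuous_attains_inf[of "sphere (0 :: real ^ 'n) 1" "\<lambda>s. norm (lincomb c s)"] by auto
  have "u \<noteq> 0" using u by auto
  then have pos: "norm (lincomb c u) > 0"
    using assms linear_injective_0[OF linear_lincomb, of c] by auto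
  have "norm (lincomb c u) * norm s \<le> norm (lincomb c s)" for s
  proof (cases "s = 0")
    case False
    have "norm (lincomb c u) \<le> norm (lincomb c (s /\<^sub>R norm s))"
      using False by (intro min) simp
    also have "\<dots> = norm (lincomb c s) / norm s"
      by (simp add: linear_cmul[OF linear_lincomb] divide_inverse mult.commute)
    finally show ?thesis using False by (simp add: pos_le_divide_eq)
  qed (simp add: linear_0[OF linear_lincomb])
  then have "min 1 (norm (lincomb c u)) * norm s \<le> norm (lincomb c s)" for s
    by (meson min.cobounded2 mult_right_mono norm_ge_zero order_trans)
  with pos show thesis by (intro that[of "min 1 (norm (lincomb c u))"]) auto
qed

text \<open>Independence modulo a subspace of the right codimension already implies spanning. Expressing
  the vectors in a basis \<open>b\<close> of the quotient turns them into an injective linear endomorphism of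
  \<open>\<real>\<^sup>n\<close>, which is therefore surjective.\<close>
lemma direct_sum_decomp_range_lincomb:
  fixes x :: "'a::real_vector ^ 'n"
  assumes V: "subspace V" and "has_codim V CARD('n)"
    and indep: "\<And>s. lincomb x s \<in> V \<Longrightarrow> s = 0"
  shows "direct_sum_decomp (range (lincomb x)) V"
proof -
  obtain B where B: "basis_modulo V B" "card B = CARD('n)"
    using assms(2) by (auto simp: has_codim_def)
  have "finite B" using B(2) by (intro card_ge_0_finite) simp
  then obtain h :: "'n \<Rightarrow> 'a" where h: "bij_betw h UNIV B"
    using finite_same_card_bij[of "UNIV :: 'n set" B] B(2) by auto
  define b where "b = (\<chi> i. h i)"
  have repr: "\<exists>u. z - lincomb b u \<in> V" for z
  proof -
    obtain u where "z - (\<Sum>v\<in>B. u v *\<^sub>R v) \<in> V"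
      using B(1) unfolding basis_modulo_def by blast
    then have "z - lincomb b (\<chi> i. u (h i)) \<in> V"
      by (simp add: lincomb_def b_def sum.reindex_bij_betw[OF h, of "\<lambda>v. u v *\<^sub>R v"])
    then show ?thesis ..
  qed
  define U where "U i = (SOME u. x $ i - lincomb b u \<in> V)" for i
  have U: "x $ i - lincomb b (U i) \<in> V" for i
    unfolding U_def by (rule someI_ex) (rule repr)
  \<comment> \<open>\<open>T s\<close> is the coordinate vector, with respect to \<open>b\<close>, of \<open>lincomb x s\<close> modulo \<open>V\<close>.\<close>
  define T where "T = lincomb (\<chi> i. U i)"
  have T: "lincomb x s - lincomb b (T s) \<in> V" for s
  proof -
    have "lincomb x s - lincomb b (T s) = (\<Sum>i\<in>UNIV. s $ i *\<^sub>R (x $ i - lincomb b (U i)))"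
      by (simp add: T_def lincomb_def[of x] lincomb_def[of "\<chi> i. U i"] linear_sum[OF linear_lincomb]
          linear_cmul[OF linear_lincomb] scaleR_right_diff_distrib sum_subtractf)
    also have "\<dots> \<in> V"
      by (intro subspace_sum[OF V] subspace_scale[OF V] U)
    finally show ?thesis .
  qed
  have linT: "linear T" by (simp add: T_def linear_lincomb)
  have "s = 0" if "T s = 0" for s
    using T[of s] that by (intro indep) (simp add: linear_0[OF linear_lincomb])
  then have "inj T" by (simp add: linear_injective_0[OF linT])
  then have "surj T" using linear_injective_imp_surjective[OF linT] by simp
  have "\<exists>s v. z = lincomb x s + v \<and> v \<in> V" for z
  proof -
    obtain u where u: "z - lincomb b u \<in> V" using repr by blast
    obtain s where s: "u = T s" using \<open>surj T\<close> by (meson surjD)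
    have "z - lincomb x s = (z - lincomb b u) - (lincomb x s - lincomb b (T s))"
      by (simp add: s)
    also have "\<dots> \<in> V" by (intro subspace_diff[OF V] u T)
    finally show ?thesis by (intro exI[of _ s] exI[of _ "z - lincomb x s"]) simp
  qed
  then have "{c + v |c v. c \<in> range (lincomb x) \<and> v \<in> V} = UNIV"
    by (auto; blast)
  moreover have "range (lincomb x) \<inter> V = {0}"
  proof (rule set_eqI, rule iffI)
    fix z assume "z \<in> range (lincomb x) \<inter> V"
    then show "z \<in> {0}" using indep linear_0[OF linear_lincomb, of x] by auto
  next
    fix z :: 'a assume "z \<in> {0}"
    then have "z = lincomb x 0" by (simp add: linear_0[OF linear_lincomb])
    then show "z \<in> range (lincomb x) \<inter> V"
      using \<open>z \<in> {0}\<close> subspace_0[OF V] by auto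
  qed
  ultimately show ?thesis by (simp add: direct_sum_decomp_def)
qed

lemma infdist_cong_mod_subspace:
  fixes x y :: "'a::real_normed_vector"
  assumes V: "subspace V" and xy: "x - y \<in> V"
  shows "infdist x V = infdist y V"
proof -
  have le: "infdist x V \<le> infdist y V" if "x - y \<in> V" for x y :: 'a
  proof -
    have "V \<noteq> {}" using subspace_0[OF V] by auto
    moreover have "infdist x V \<le> dist y v" if "v \<in> V" for v
    proof -
      have "infdist x V \<le> dist x (v + (x - y))"
        by (intro infdist_le subspace_add[OF V] that \<open>x - y \<in> V\<close>)
      also have "dist x (v + (x - y)) = dist y v" by (simp add: dist_norm)
      finally show ?thesis .
    qed
    ultimately show ?thesis
      unfolding infdist_notempty[OF \<open>V \<noteq> {}\<close>, of y] by (intro cINF_greatest)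
  qed
  show ?thesis
    using le[OF xy] le[of y x] subspace_neg[OF V xy] by (simp add: le_antisym)
qed

section \<open>Separation of a tuple from a subspace\<close>

lemma INF_infdist_unit_mult_norm_le:
  fixes w :: "'a::real_normed_vector"
  assumes V: "subspace V" and C: "subspace C" "w \<in> C"
  shows "(INF x\<in>{x \<in> C. norm x = 1}. infdist x V) * norm w \<le> infdist w V"
proof (cases "w = 0")
  case False
  have "V \<noteq> {}" using subspace_0[OF V] by auto
  define u where "u = w /\<^sub>R norm w"
  have u: "u \<in> {x \<in> C. norm x = 1}"
    using False C by (simp add: u_def subspace_scale)
  have "(INF x\<in>{x \<in> C. norm x = 1}. infdist x V) * norm w \<le> dist w v" if "v \<in> V" for v
  proof -
    have "(INF x\<in>{x \<in> C. norm x = 1}. infdist x V) \<le> infdist u V"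
      by (rule cINF_lower[OF _ u]) (auto intro!: bdd_belowI[of _ 0] infdist_nonneg)
    also have "\<dots> \<le> dist u (v /\<^sub>R norm w)"
      by (intro infdist_le subspace_scale V that)
    also have "\<dots> = dist w v / norm w"
      by (simp add: u_def dist_norm divide_inverse mult.commute flip: scaleR_diff_right)
    finally show ?thesis using False by (simp add: pos_le_divide_eq)
  qed
  then show ?thesis
    unfolding infdist_notempty[OF \<open>V \<noteq> {}\<close>] by (intro cINF_greatest \<open>V \<noteq> {}\<close>)
qed (simp add: infdist_nonneg)

text \<open>Separation is measured against the coefficient vector instead of the norm of the combination.
  This gives a closed condition on the tuple, forces independence modulo \<open>V\<close> as soon as \<open>\<theta> > 0\<close>, and
  differs from the separation of the span only by a factor that depends on the tuple alone.\<close>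
definition separates :: "real \<Rightarrow> 'a::real_normed_vector set \<Rightarrow> 'a ^ 'n \<Rightarrow> bool" where
  "separates \<theta> V x \<longleftrightarrow> (\<forall>s. \<theta> * norm s \<le> infdist (lincomb x s) V)"

lemma separates_mono: "separates \<theta> V x \<Longrightarrow> \<theta>' \<le> \<theta> \<Longrightarrow> separates \<theta>' V x"
  unfolding separates_def by (meson mult_right_mono norm_ge_zero order_trans)

lemma closed_separates: "closed {x. separates \<theta> V x}"
proof -
  have "{x. separates \<theta> V x} = (\<Inter>s. {x. \<theta> * norm s \<le> infdist (lincomb x s) V})"
    by (auto simp: separates_def)
  also have "closed \<dots>"
    unfolding lincomb_def
    by (intro closed_INT ballI closed_Collect_le continuous_intros)
  finally show ?thesis .
qed

text \<open>The norm of a combination is at most a constant \<open>M\<close> times that of its coefficient vector, so the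
  span has separation constants \<open>\<theta>\<^sub>j / M\<close>. A factor independent of \<open>j\<close> does not affect the exponential
  rate.\<close>
lemma well_separating_if_separates:
  fixes V :: "nat \<Rightarrow> 'a::real_normed_vector set" and x :: "'a ^ 'n"
  assumes V: "\<And>j. j \<ge> 1 \<Longrightarrow> V j \<in> closed_subspaces_of_codim CARD('n)"
    and pos: "\<And>j. j \<ge> 1 \<Longrightarrow> \<theta> j > 0"
    and sep: "\<And>j. j \<ge> 1 \<Longrightarrow> separates (\<theta> j) (V j) x"
    and lim: "(\<lambda>j. ln (\<theta> j) / real j) \<longlonglongrightarrow> 0"
  shows "well_separating CARD('n) V (span (range (\<lambda>i. x $ i)))"
proof -
  have Vj: "subspace (V j)" "has_codim (V j) CARD('n)" if "j \<ge> 1" for j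
    using V[OF that] by (auto simp: closed_subspaces_of_codim_def)
  have indep: "s = 0" if "j \<ge> 1" "lincomb x s \<in> V j" for j s
    using sep[OF that(1)] pos[OF that(1)] that(2)
    by (auto simp: separates_def mult_le_0_iff dest!: spec[of _ s])
  have inj: "inj (lincomb x)"
    using indep[of 1] subspace_0[OF Vj(1)[of 1]]
    by (auto simp: linear_injective_0[OF linear_lincomb])
  define C where "C = span (range (\<lambda>i. x $ i))"
  have C: "C = range (lincomb x)" by (simp add: C_def span_range_nth)
  have cc: "common_complement CARD('n) V C"
    unfolding common_complement_def
    using subspaces_of_dim_span_range_nth[OF inj] direct_sum_decomp_range_lincomb[OF Vj] indep
    by (auto simp: C_def[symmetric]) (simp add: C)
  have "x \<noteq> 0"
  proof
    assume "x = 0"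
    then have "lincomb x 1 = 0" by (simp add: lincomb_def)
    with inj show False
      by (metis linear_injective_0[OF linear_lincomb] zero_neq_one)
  qed
  define M where "M = CARD('n) * norm x"
  have "M > 0" using \<open>x \<noteq> 0\<close> by (simp add: M_def)
  have "delta_separating CARD('n) V (\<lambda>j. \<theta> j / M) C"
    unfolding delta_separating_def
  proof (intro conjI cc allI impI)
    fix j :: nat assume j: "j \<ge> 1"
    obtain i where "x $ i \<noteq> 0" using \<open>x \<noteq> 0\<close> by (auto simp: vec_eq_iff)
    moreover have "x $ i /\<^sub>R norm (x $ i) \<in> C"
      unfolding C_def by (intro span_scale span_base rangeI)
    ultimately have "x $ i /\<^sub>R norm (x $ i) \<in> {u \<in> C. norm u = 1}"
      by simp
    then show "\<theta> j / M \<le> (INF u\<in>{u \<in> C. norm u = 1}. infdist u (V j))"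
    proof (intro cINF_greatest)
      fix u assume "u \<in> {u \<in> C. norm u = 1}"
      then obtain s where s: "u = lincomb x s" "norm u = 1" by (auto simp: C)
      have "1 \<le> M * norm s" using norm_lincomb_le[of x s] s by (simp add: M_def)
      then have "\<theta> j / M \<le> \<theta> j * norm s"
        using pos[OF j] \<open>M > 0\<close> by (simp add: pos_divide_le_eq mult_ac)
      also have "\<dots> \<le> infdist u (V j)" using sep[OF j] s(1) by (simp add: separates_def)
      finally show "\<theta> j / M \<le> infdist u (V j)" .
    qed auto
  qed
  moreover have "(\<lambda>j. (1 / real j) * ln (\<theta> j / M)) \<longlonglongrightarrow> 0"
  proof -
    have "(\<lambda>j. ln (\<theta> j) / real j - ln M * (1 / real j)) \<longlonglongrightarrow> 0 - ln M * 0"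
      by (intro tendsto_intros lim lim_1_over_n)
    then have "(\<lambda>j. ln (\<theta> j) / real j - ln M * (1 / real j)) \<longlonglongrightarrow> 0" by simp
    moreover have "\<forall>\<^sub>F j in sequentially.
        ln (\<theta> j) / real j - ln M * (1 / real j) = (1 / real j) * ln (\<theta> j / M)"
      using eventually_ge_at_top[of 1]
    proof eventually_elim
      case (elim j)
      then show ?case using pos[of j] \<open>M > 0\<close> by (simp add: ln_div diff_divide_distrib)
    qed
    ultimately show ?thesis by (rule Lim_transform_eventually)
  qed
  ultimately show ?thesis
    unfolding well_separating_def C_def[symmetric]
    using pos \<open>M > 0\<close> by (intro exI[of _ "\<lambda>j. \<theta> j / M"]) auto
qed

section \<open>Separation along a line\<close>

text \<open>The core estimate. Modulo \<open>V\<close>, the tuple \<open>t c + y\<close> has the matrix \<open>t I + Z\<close> with respect to \<open>c\<close>,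
  where the entries of \<open>Z\<close> are at most \<open>norm y / \<eta>\<close>, and \<open>p\<close> is its determinant as a function of \<open>t\<close>.
  One factor \<open>\<eta>\<close> is the separation of \<open>c\<close> itself; the other \<open>n - 1\<close> come from the bound on the entries
  in \<open>det_mult_norm_le\<close>.\<close>
lemma separates_shift_along:
  fixes c y :: "'a::real_normed_vector ^ 'n"
  assumes V: "subspace V"
    and \<eta>: "0 < \<eta>" "\<eta> \<le> 1" and sep: "separates \<eta> V c"
    and sum: "\<And>z. \<exists>s. z - lincomb c s \<in> V"
  obtains p where "degree p = CARD('n)" "lead_coeff p = 1"
    "\<And>t. separates (\<eta> ^ CARD('n) * \<bar>poly p t\<bar>
        / (CARD('n) * fact CARD('n) * (1 + \<bar>t\<bar> + norm y) ^ (CARD('n) - 1))) V (t *\<^sub>R c + y)"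
proof -
  define q where "q i = (SOME s. y $ i - lincomb c s \<in> V)" for i
  have q: "y $ i - lincomb c (q i) \<in> V" for i
    unfolding q_def by (rule someI_ex) (rule sum)
  define Z where "Z = (\<chi> l i. q i $ l)"
  have Z_le: "\<bar>Z $ l $ i\<bar> \<le> norm y / \<eta>" for l i
  proof -
    have "\<eta> * norm (q i) \<le> infdist (lincomb c (q i)) V"
      using sep by (simp add: separates_def)
    also have "\<dots> = infdist (y $ i) V"
      by (rule infdist_cong_mod_subspace[OF V, symmetric]) (rule q)
    also have "\<dots> \<le> norm (y $ i)"
      using infdist_le[OF subspace_0[OF V], of "y $ i"] by simp
    also have "\<dots> \<le> norm y" by (rule Finite_Cartesian_Product.norm_nth_le)
    finally have "norm (q i) \<le> norm y / \<eta>" using \<eta> by (simp add: pos_le_divide_eq mult.commute)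
    then show ?thesis
      using component_le_norm_cart[of "q i" l] by (simp add: Z_def)
  qed
  have shift: "lincomb (t *\<^sub>R c + y) s - lincomb c ((mat t + Z) *v s) \<in> V" for t s
  proof -
    have "Z *v s = (\<Sum>i\<in>UNIV. s $ i *\<^sub>R q i)"
      by (simp add: vec_eq_iff matrix_vector_mult_def Z_def mult.commute)
    moreover have "mat t *v s = t *\<^sub>R s"
      by (simp add: vec_eq_iff matrix_vector_mult_def mat_def if_distrib[of "\<lambda>r. r * _"] cong: if_cong)
    ultimately have "lincomb (t *\<^sub>R c + y) s - lincomb c ((mat t + Z) *v s)
        = (\<Sum>i\<in>UNIV. s $ i *\<^sub>R (y $ i - lincomb c (q i)))"
      by (simp add: lincomb_add_left lincomb_scaleR_left matrix_vector_mult_add_rdistrib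
          linear_add[OF linear_lincomb] linear_sum[OF linear_lincomb]
          linear_cmul[OF linear_lincomb] lincomb_def[of y] scaleR_right_diff_distrib sum_subtractf)
    also have "\<dots> \<in> V"
      by (intro subspace_sum[OF V] subspace_scale[OF V] q)
    finally show ?thesis .
  qed
  obtain p where p: "degree p = CARD('n)" "lead_coeff p = 1" "\<And>t. poly p t = det (mat t + Z)"
    using det_shift_monic_poly[of Z] by blast
  have "separates (\<eta> ^ CARD('n) * \<bar>poly p t\<bar>
      / (CARD('n) * fact CARD('n) * (1 + \<bar>t\<bar> + norm y) ^ (CARD('n) - 1))) V (t *\<^sub>R c + y)" for t
    unfolding separates_def
  proof
    fix s :: "real ^ 'n"
    define B where "B = mat t + Z"
    define R where "R = 1 + \<bar>t\<bar> + norm y"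
    define K where "K = CARD('n) * fact CARD('n) * R ^ (CARD('n) - 1)"
    have "R > 0" by (simp add: R_def add_pos_nonneg)
    then have "K > 0" by (simp add: K_def)
    have B_le: "\<bar>B $ i $ j\<bar> \<le> R / \<eta>" for i j
    proof -
      have "\<bar>B $ i $ j\<bar> \<le> \<bar>t\<bar> + norm y / \<eta>"
        using Z_le[of i j] by (auto simp: B_def mat_def)
      also have "\<dots> \<le> (1 + \<bar>t\<bar>) / \<eta> + norm y / \<eta>"
        using \<eta> by (simp add: pos_le_divide_eq) (smt (verit) mult_left_le)
      finally show ?thesis by (simp add: R_def add_divide_distrib)
    qed
    have power_\<eta>: "\<eta> ^ CARD('n) = \<eta> * \<eta> ^ (CARD('n) - 1)"
      by (simp flip: power_Suc)
    have "\<bar>det B\<bar> * norm s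
        \<le> CARD('n) * fact CARD('n) * (R / \<eta>) ^ (CARD('n) - 1) * norm (B *v s)"
      by (rule det_mult_norm_le) (rule B_le)
    then have "\<eta> ^ CARD('n) * (\<bar>det B\<bar> * norm s)
        \<le> \<eta> ^ CARD('n) * (CARD('n) * fact CARD('n) * (R / \<eta>) ^ (CARD('n) - 1) * norm (B *v s))"
      using \<eta> by (intro mult_left_mono) auto
    also have "\<dots> = K * (\<eta> * norm (B *v s))"
      using \<eta> by (simp add: K_def power_\<eta> power_divide)
    also have "\<dots> \<le> K * infdist (lincomb c (B *v s)) V"
      using sep \<open>K > 0\<close> by (simp add: separates_def)
    also have "infdist (lincomb c (B *v s)) V = infdist (lincomb (t *\<^sub>R c + y) s) V"
      using shift[of t s] by (intro infdist_cong_mod_subspace[OF V, symmetric]) (simp add: B_def)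
    finally have "\<eta> ^ CARD('n) * \<bar>poly p t\<bar> / K * norm s \<le> infdist (lincomb (t *\<^sub>R c + y) s) V"
      using \<open>K > 0\<close> by (simp add: p(3) B_def[symmetric] pos_divide_le_eq mult_ac)
    then show "\<eta> ^ CARD('n) * \<bar>poly p t\<bar>
      / (CARD('n) * fact CARD('n) * (1 + \<bar>t\<bar> + norm y) ^ (CARD('n) - 1)) * norm s
      \<le> infdist (lincomb (t *\<^sub>R c + y) s) V"
      unfolding K_def R_def .
  qed
  with p(1,2) show thesis by (rule that)
qed

text \<open>A Borel--Cantelli argument. The exceptional sets \<open>S m\<close> collect those \<open>t\<close> for which one of the
  determinants falls below \<open>(1 / (m j\<^sup>2))\<^sup>n\<close>. Their measures are bounded by a multiple of
  \<open>\<Sum>\<^sub>j 1 / (m j\<^sup>2)\<close>, which tends to \<open>0\<close> with \<open>1 / m\<close>, so their intersection is a null set. A parameter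
  outside some \<open>S m\<close> satisfies the claim, with a constant that absorbs \<open>m\<^sup>n\<close> and the dependence on
  \<open>t\<close> and \<open>y\<close>.\<close>
lemma separates_along_line_ae:
  fixes V :: "nat \<Rightarrow> 'a::real_normed_vector set" and c y :: "'a ^ 'n"
  assumes V: "\<And>j. j \<ge> 1 \<Longrightarrow> subspace (V j)"
    and \<eta>: "\<And>j. j \<ge> 1 \<Longrightarrow> 0 < \<eta> j \<and> \<eta> j \<le> 1"
    and sep: "\<And>j. j \<ge> 1 \<Longrightarrow> separates (\<eta> j) (V j) c"
    and sum: "\<And>j z. j \<ge> 1 \<Longrightarrow> \<exists>s. z - lincomb c s \<in> V j"
  shows "AE t in lborel. \<exists>m\<ge>1. \<forall>j\<ge>1.
    separates ((\<eta> j / (real j)\<^sup>2) ^ CARD('n) / real m) (V j) (t *\<^sub>R c + y)"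
proof -
  let ?k = "CARD('n)"
  define K where "K t = ?k * fact ?k * (1 + \<bar>t\<bar> + norm y) ^ (?k - 1)" for t :: real
  have K: "K t > 0" for t by (simp add: K_def add_pos_nonneg)
  have "\<exists>p. degree p = ?k \<and> lead_coeff p = 1
      \<and> (\<forall>t. separates (\<eta> j ^ ?k * \<bar>poly p t\<bar> / K t) (V j) (t *\<^sub>R c + y))" if "j \<ge> 1" for j
    unfolding K_def
    using separates_shift_along[OF V[OF that] _ _ sep[OF that] sum[OF that], of y] \<eta>[OF that]
    by metis
  then obtain p where p: "\<And>j. j \<ge> 1 \<Longrightarrow> degree (p j) = ?k" "\<And>j. j \<ge> 1 \<Longrightarrow> lead_coeff (p j) = 1"
    and p_sep: "\<And>j t. j \<ge> 1 \<Longrightarrow> separates (\<eta> j ^ ?k * \<bar>poly (p j) t\<bar> / K t) (V j) (t *\<^sub>R c + y)"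
    by metis
  \<comment> \<open>Both indices are shifted by one, since \<open>m\<close> and \<open>j\<close> start from \<open>1\<close>.\<close>
  define N where "N m j = {t. \<bar>poly (p (Suc j)) t\<bar> < (1 / (real (Suc m) * (real (Suc j))\<^sup>2)) ^ ?k}" for m j
  define S where "S m = (\<Union>j. N m j)" for m
  have N_sets: "N m j \<in> sets lborel" for m j
    unfolding N_def by (simp add: borel_open open_Collect_less continuous_intros)
  then have S_sets: "S m \<in> sets lborel" for m
    unfolding S_def by blast
  have N_le: "emeasure lborel (N m j)
      \<le> ennreal (2 * ?k / real (Suc m) * (1 / (real j + 1)\<^sup>2))" for m j
    using emeasure_small_values_monic_poly[of "p (Suc j)" "1 / (real (Suc m) * (real (Suc j))\<^sup>2)"] p[of "Suc j"]
    by (simp add: N_def add.commute)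
  have summ: "(\<lambda>j. 2 * ?k / real (Suc m) * (1 / (real j + 1)\<^sup>2))
      sums (2 * ?k / real (Suc m) * (pi\<^sup>2 / 6))" for m
    using inverse_squares_sums by (intro sums_mult) (simp add: add.commute)
  have S_le: "emeasure lborel (S m) \<le> ennreal (2 * ?k / real (Suc m) * (pi\<^sup>2 / 6))" for m
  proof -
    have "emeasure lborel (S m) \<le> (\<Sum>j. emeasure lborel (N m j))"
      unfolding S_def by (rule emeasure_subadditive_countably) (use N_sets in auto)
    also have "\<dots> \<le> (\<Sum>j. ennreal (2 * ?k / real (Suc m) * (1 / (real j + 1)\<^sup>2)))"
      by (intro suminf_le N_le) auto
    also have "\<dots> = ennreal (2 * ?k / real (Suc m) * (pi\<^sup>2 / 6))"
      using summ[of m] by (subst suminf_ennreal2) (auto simp: sums_iff)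
    finally show ?thesis .
  qed
  have lim: "(\<lambda>m. ennreal (2 * ?k / real (Suc m) * (pi\<^sup>2 / 6))) \<longlonglongrightarrow> 0"
  proof -
    have "(\<lambda>m. 2 * ?k * (pi\<^sup>2 / 6) * (1 / real (Suc m))) \<longlonglongrightarrow> 2 * ?k * (pi\<^sup>2 / 6) * 0"
      by (intro tendsto_intros LIMSEQ_Suc[OF lim_1_over_n])
    then have "(\<lambda>m. ennreal (2 * ?k * (pi\<^sup>2 / 6) * (1 / real (Suc m)))) \<longlonglongrightarrow> ennreal 0"
      by (intro tendsto_ennrealI) simp
    then show ?thesis by (simp add: mult_ac)
  qed
  have "emeasure lborel (\<Inter>m. S m) \<le> ennreal (2 * ?k / real (Suc m) * (pi\<^sup>2 / 6))" for m
    by (rule order_trans[OF emeasure_mono S_le]) (use S_sets in auto)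
  then have "emeasure lborel (\<Inter>m. S m) \<le> 0"
    by (intro LIMSEQ_le_const[OF lim]) auto
  then have null: "(\<Inter>m. S m) \<in> null_sets lborel"
    using S_sets by (intro null_setsI) auto
  show ?thesis
  proof (rule AE_I'[OF null], safe)
    fix t m
    assume no: "\<not> (\<exists>m\<ge>1. \<forall>j\<ge>1.
      separates ((\<eta> j / (real j)\<^sup>2) ^ ?k / real m) (V j) (t *\<^sub>R c + y))"
    show "t \<in> S m"
    proof (rule ccontr)
      assume "t \<notin> S m"
      define M where "M = nat \<lceil>real (Suc m) ^ ?k * K t\<rceil>"
      have M: "real M \<ge> real (Suc m) ^ ?k * K t" unfolding M_def by linarith
      have pos: "real (Suc m) ^ ?k * K t > 0" using K[of t] by simp
      with M have "real M > 0" by linarith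
      have "separates ((\<eta> j / (real j)\<^sup>2) ^ ?k / real M) (V j) (t *\<^sub>R c + y)" if j: "j \<ge> 1" for j
      proof (rule separates_mono[OF p_sep[OF j]])
        have "t \<notin> N m (j - 1)" using \<open>t \<notin> S m\<close> by (auto simp: S_def)
        then have large: "(1 / (real (Suc m) * (real j)\<^sup>2)) ^ ?k \<le> \<bar>poly (p j) t\<bar>"
          using j by (simp add: N_def)
        have "(\<eta> j / (real j)\<^sup>2) ^ ?k / real M
            \<le> (\<eta> j / (real j)\<^sup>2) ^ ?k / (real (Suc m) ^ ?k * K t)"
          using M pos \<eta>[OF j] by (intro divide_left_mono) auto
        also have "\<dots> = \<eta> j ^ ?k * (1 / (real (Suc m) * (real j)\<^sup>2)) ^ ?k / K t"
          by (simp add: power_divide power_mult_distrib)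
        also have "\<dots> \<le> \<eta> j ^ ?k * \<bar>poly (p j) t\<bar> / K t"
          using large \<eta>[OF j] K[of t] by (intro divide_right_mono mult_left_mono) auto
        finally show "(\<eta> j / (real j)\<^sup>2) ^ ?k / real M \<le> \<eta> j ^ ?k * \<bar>poly (p j) t\<bar> / K t" .
      qed
      moreover have "M \<ge> 1" using \<open>real M > 0\<close> by simp
      ultimately show False using no by blast
    qed
  qed
qed

section \<open>Prevalence of well-separating complements\<close>

theorem proposition3p20:
  fixes V :: "nat \<Rightarrow> 'a::banach set"
  assumes "\<forall>j\<ge>1. V j \<in> closed_subspaces_of_codim CARD('n::finite)"
    and "\<exists>C. well_separating CARD('n) V C"
  shows "prevalent {x :: 'a ^ 'n. well_separating CARD('n) V (span (range (\<lambda>i. x $ i)))}"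
proof -
  let ?k = "CARD('n)"
  have V: "V j \<in> closed_subspaces_of_codim ?k" if "j \<ge> 1" for j
    using assms(1) that by blast
  have sub: "subspace (V j)" if "j \<ge> 1" for j
    using V[OF that] by (simp add: closed_subspaces_of_codim_def)
  obtain C \<delta> where \<delta>: "\<And>j. j \<ge> 1 \<Longrightarrow> \<delta> j > 0" "delta_separating ?k V \<delta> C"
    and lim_\<delta>: "(\<lambda>j. (1 / real j) * ln (\<delta> j)) \<longlonglongrightarrow> 0"
    using assms(2) by (auto simp: well_separating_def)
  have C: "C \<in> subspaces_of_dim ?k" "\<And>j. j \<ge> 1 \<Longrightarrow> direct_sum_decomp C (V j)"
    and C_inf: "\<And>j. j \<ge> 1 \<Longrightarrow> \<delta> j \<le> (INF x\<in>{x \<in> C. norm x = 1}. infdist x (V j))"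
    using \<delta>(2) by (auto simp: delta_separating_def common_complement_def)
  obtain c :: "'a ^ 'n" where c: "C = range (lincomb c)" "inj (lincomb c)"
    using C(1) by (rule subspaces_of_dim_imp_lincomb)
  obtain \<kappa> where \<kappa>: "\<kappa> > 0" "\<kappa> \<le> 1" "\<And>s. \<kappa> * norm s \<le> norm (lincomb c s)"
    using lincomb_bounded_below[OF c(2)] by blast
  have \<delta>_le: "\<delta> j * norm (lincomb c s) \<le> infdist (lincomb c s) (V j)" if j: "j \<ge> 1" for j s
  proof -
    have "subspace C" using C(1) by (simp add: subspaces_of_dim_def)
    then have "(INF x\<in>{x \<in> C. norm x = 1}. infdist x (V j)) * norm (lincomb c s)
        \<le> infdist (lincomb c s) (V j)"
      by (intro INF_infdist_unit_mult_norm_le sub j) (simp_all add: c(1))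
    with C_inf[OF j] show ?thesis by (meson mult_right_mono norm_ge_zero order_trans)
  qed
  have c1_ne: "lincomb c 1 \<noteq> 0"
    using c(2) by (metis linear_injective_0[OF linear_lincomb] zero_neq_one)
  define \<eta> where "\<eta> j = \<kappa> * \<delta> j" for j
  have \<eta>: "0 < \<eta> j \<and> \<eta> j \<le> 1" if j: "j \<ge> 1" for j
  proof -
    have "\<delta> j * norm (lincomb c 1) \<le> 1 * norm (lincomb c 1)"
      using \<delta>_le[OF j, of 1] infdist_le[OF subspace_0[OF sub[OF j]], of "lincomb c 1"] by simp
    then have "\<delta> j \<le> 1" using c1_ne by simp
    then show ?thesis
      using \<kappa>(1,2) \<delta>(1)[OF j] by (simp add: \<eta>_def mult_le_one)
  qed
  have sep_c: "separates (\<eta> j) (V j) c" if j: "j \<ge> 1" for j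
    unfolding separates_def
  proof
    fix s :: "real ^ 'n"
    have "\<eta> j * norm s = \<delta> j * (\<kappa> * norm s)" by (simp add: \<eta>_def)
    also have "\<dots> \<le> \<delta> j * norm (lincomb c s)"
      using \<delta>(1)[OF j] \<kappa>(3)[of s] by (simp add: mult_left_mono)
    finally show "\<eta> j * norm s \<le> infdist (lincomb c s) (V j)"
      using \<delta>_le[OF j, of s] by linarith
  qed
  have sum_c: "\<exists>s. z - lincomb c s \<in> V j" if "j \<ge> 1" for j z
  proof -
    have "z \<in> {a + v |a v. a \<in> C \<and> v \<in> V j}"
      using C(2)[OF that] by (simp add: direct_sum_decomp_def)
    then obtain s v where "z = lincomb c s + v" "v \<in> V j" by (auto simp: c(1))
    then show ?thesis by (intro exI[of _ s]) simp
  qed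
  \<comment> \<open>The constants must be fixed before the tuple is known, so that the set of good tuples is visibly
    Borel. The parameter \<open>m\<close> accounts for the dependence on the tuple.\<close>
  define \<theta> where "\<theta> m j = (\<eta> j / (real j)\<^sup>2) ^ ?k / real m" for m j
  have \<theta>_pos: "\<theta> m j > 0" if "m \<ge> 1" "j \<ge> 1" for m j
    using \<eta>[OF that(2)] that by (simp add: \<theta>_def)
  have lim_\<theta>: "(\<lambda>j. ln (\<theta> m j) / real j) \<longlonglongrightarrow> 0" if m: "m \<ge> 1" for m
  proof -
    have "(\<lambda>j. ?k * (ln \<kappa> * (1 / real j) + (1 / real j) * ln (\<delta> j) - 2 * (ln (real j) / real j))
        - ln (real m) * (1 / real j)) \<longlonglongrightarrow> ?k * (ln \<kappa> * 0 + 0 - 2 * 0) - ln (real m) * 0"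
      by (intro tendsto_intros lim_1_over_n lim_\<delta> lim_ln_over_n)
    then have "(\<lambda>j. ?k * (ln \<kappa> * (1 / real j) + (1 / real j) * ln (\<delta> j) - 2 * (ln (real j) / real j))
        - ln (real m) * (1 / real j)) \<longlonglongrightarrow> 0"
      by simp
    moreover have "\<forall>\<^sub>F j in sequentially.
        ?k * (ln \<kappa> * (1 / real j) + (1 / real j) * ln (\<delta> j) - 2 * (ln (real j) / real j))
          - ln (real m) * (1 / real j) = ln (\<theta> m j) / real j"
      using eventually_ge_at_top[of 1]
    proof eventually_elim
      case (elim j)
      have eq: "ln (\<theta> m j) = ?k * (ln \<kappa> + ln (\<delta> j) - 2 * ln (real j)) - ln (real m)"
        using \<eta>[OF elim] \<delta>(1)[OF elim] \<kappa>(1) m elim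
        by (simp add: \<theta>_def \<eta>_def ln_div ln_mult ln_realpow)
      show ?case
        unfolding eq by (simp add: algebra_simps add_divide_distrib diff_divide_distrib)
    qed
    ultimately show ?thesis by (rule Lim_transform_eventually)
  qed
  define E where "E = (\<Union>m\<in>{1..}. \<Inter>j\<in>{1..}. {x :: 'a ^ 'n. separates (\<theta> m j) (V j) x})"
  have E_borel: "E \<in> sets borel"
    unfolding E_def
    by (rule sets.countable_UN'') (auto intro!: borel_closed closed_INT closed_separates)
  have E_sub: "E \<subseteq> {x. well_separating ?k V (span (range (\<lambda>i. x $ i)))}"
  proof
    fix x assume "x \<in> E"
    then obtain m where "m \<ge> 1" "\<And>j. j \<ge> 1 \<Longrightarrow> separates (\<theta> m j) (V j) x"
      by (auto simp: E_def)
    then have "well_separating ?k V (span (range (\<lambda>i. x $ i)))"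
      by (intro well_separating_if_separates[of V "\<theta> m"] V \<theta>_pos lim_\<theta>)
    then show "x \<in> {x. well_separating ?k V (span (range (\<lambda>i. x $ i)))}" by simp
  qed
  define f where "f t = t *\<^sub>R c" for t :: real
  have f_cont: "continuous_on UNIV f"
    unfolding f_def by (intro continuous_intros)
  have f_meas: "f \<in> borel_measurable lborel"
    using borel_measurable_continuous_onI[OF f_cont] by simp
  have f_inj: "inj f"
    using c1_ne by (auto simp: inj_def f_def lincomb_def)
  define \<mu> where "\<mu> = distr lborel borel f"
  have "prevalent_borel E"
    unfolding prevalent_borel_def
  proof (intro conjI E_borel exI[of _ \<mu>] allI)
    show "sets \<mu> = sets borel" by (simp add: \<mu>_def)
    have "compact (f ` {0..1})"
      by (intro compact_continuous_image continuous_on_subset[OF f_cont]) auto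
    moreover have "f -` f ` {0..1} = {0..1}"
      by (rule inj_vimage_image_eq[OF f_inj])
    ultimately have "compact (f ` {0..1})" "emeasure \<mu> (f ` {0..1}) = 1"
      by (auto simp: \<mu>_def emeasure_distr[OF f_meas] compact_imp_closed)
    then show "\<exists>K. compact K \<and> 0 < emeasure \<mu> K \<and> emeasure \<mu> K < \<infinity>"
      by (intro exI[of _ "f ` {0..1}"]) auto
    fix y
    have translate: "UNIV - (\<lambda>x. x + y) ` E = (\<lambda>x. x - y) -` (UNIV - E)"
      by (auto simp: image_iff) (metis diff_add_cancel)
    have meas: "(\<lambda>x. x - y) \<in> borel_measurable borel"
      by (intro borel_measurable_continuous_onI continuous_intros)
    have sets: "UNIV - (\<lambda>x. x + y) ` E \<in> sets borel"
      unfolding translate using measurable_sets[OF meas, of "UNIV - E"] E_borel by (simp add: sets.Diff)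
    have "AE t in lborel. f t - y \<in> E"
      using separates_along_line_ae[of V \<eta> c "- y", OF sub \<eta> sep_c sum_c]
      by (auto simp: E_def \<theta>_def f_def Bex_def)
    then have "AE t in lborel. t \<notin> f -` (UNIV - (\<lambda>x. x + y) ` E)"
      unfolding translate by simp
    moreover have "f -` (UNIV - (\<lambda>x. x + y) ` E) \<in> sets lborel"
      using measurable_sets[OF f_meas sets] by simp
    ultimately have "emeasure lborel (f -` (UNIV - (\<lambda>x. x + y) ` E)) = 0"
      using AE_iff_measurable[of "f -` (UNIV - (\<lambda>x. x + y) ` E)" lborel
          "\<lambda>t. t \<notin> f -` (UNIV - (\<lambda>x. x + y) ` E)"] by auto
    then show "emeasure \<mu> (UNIV - (\<lambda>x. x + y) ` E) = 0"
      by (simp add: \<mu>_def emeasure_distr[OF f_meas sets])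
  qed
  with E_sub show ?thesis unfolding prevalent_def by blast
qed

end
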